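(* Let $N\ge2$, let $c_1,\dots,c_N$ be real numbers, let $\{d_{n+1}\}_{n=1}^{N-1}$ be a finite positive chain sequence, and let $\{q_{n+1}\}_{n=1}^{N-1}$ be a finite scaling sequence for $\{d_{n+1}\}_{n=1}^{N-1}$. Set $u_{n+1}^{(\pm)}=u^{(\pm)}(c_n,c_{n+1},q_{n+1})$ for $1\le n\le N-1$ and $$A_N=\min_{2\le n\le N}\frac{u_n^{(-)}}{\sqrt{1+(u_n^{(-)})^2}},\qquad B_N=\max_{2\le n\le N}\frac{u_n^{(+)}}{\sqrt{1+(u_n^{(+)})^2}}.$$ Then the zeros of $\mathcal{W}_N$ lie in $(A_N,B_N)$ and, consequently, the zeros of $R_N$ lie in the open arc $\mathcal{A}\big(2\arccos(B_N),2\arccos(A_N)\big)$.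
   Context: $\mathcal{A}(\vartheta_1,\vartheta_2)=\{e^{i\theta}:\vartheta_1<\theta<\vartheta_2\}$. The functions $\mathcal{W}_n$ on $[-1,1]$ and polynomials $R_n$, $0\le n\le N$, are generated by $$\mathcal{W}_{n+1}(x)=\big(x-c_{n+1}\sqrt{1-x^2}\big)\mathcal{W}_n(x)-d_{n+1}\mathcal{W}_{n-1}(x),\qquad \mathcal{W}_{-1}=0,\ \mathcal{W}_0=1,$$ $$R_{n+1}(z)=\big[(1+ic_{n+1})z+(1-ic_{n+1})\big]R_n(z)-4d_{n+1}zR_{n-1}(z),\qquad R_{-1}=0,\ R_0=1,$$ for $0\le n\le N-1$; they are related by $\mathcal{W}_n(\cos(\theta/2))=2^{-n}e^{-in\theta/2}R_n(e^{i\theta})$, $\theta\in[0,2\pi]$. A finite sequence $\{d_{n+1}\}_{n=1}^{N-1}$ is a finite positive chain sequence if there are $g_1,\dots,g_N$ with $0\le g_1<1$, $0<g_n<1$ for $2\le n\le N$, and $d_{n+1}=(1-g_n)g_{n+1}$ for $1\le n\le N-1$. A finite scaling sequence for it is a positive sequence $\{q_{n+1}\}_{n=1}^{N-1}$ with all $q_{n+1}\le1$ such that $\{d_{n+1}/q_{n+1}\}_{n=1}^{N-1}$ is also a finite positive chain sequence. For $a,b\in\mathbb{R}$ and $0<q<1$, $u^{(-)}(a,b,q)<u^{(+)}(a,b,q)$ are the (real) roots of $(1-q)u^2-(a+b)u+ab-q=0$. For $q=1$: $u^{(+)}(a,b,1)=+\infty$ if $a+b\ge0$, $u^{(-)}(a,b,1)=-\infty$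 if $a+b\le0$, and otherwise the value is the root $(ab-1)/(a+b)$ of the (then linear) equation. The expression $u/\sqrt{1+u^2}$ equals $\pm1$ for $u=\pm\infty$. *)

theory Defs
  imports
    Complex_Main
    "HOL-Library.Extended_Real"
    "HOL-Computational_Algebra.Polynomial"
begin

text \<open>
  Sequences with a finite range of indices are represented by total functions on \<open>nat\<close> indexed
  as in the mathematics: \<open>c 1, \<dots>, c N\<close>, \<open>d 2, \<dots>, d N\<close> and \<open>q 2, \<dots>, q N\<close>.  No other values are
  used below.
\<close>

definition open_arc :: "real \<Rightarrow> real \<Rightarrow> complex set" where
  "open_arc \<theta>\<^sub>1 \<theta>\<^sub>2 = {exp (\<i> * complex_of_real \<theta>) |\<theta>. \<theta>\<^sub>1 < \<theta> \<and> \<theta> < \<theta>\<^sub>2}"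

text \<open>
  The initial values at index \<open>-1\<close> are zero; they are absorbed in the equations for index \<open>1\<close>.
  The function \<open>Wfun c d n\<close> is only meaningful on \<open>[-1, 1]\<close>.
\<close>

fun Wfun :: "(nat \<Rightarrow> real) \<Rightarrow> (nat \<Rightarrow> real) \<Rightarrow> nat \<Rightarrow> real \<Rightarrow> real" where
  "Wfun c d 0 x = 1"
| "Wfun c d (Suc 0) x = x - c 1 * sqrt (1 - x\<^sup>2)"
| "Wfun c d (Suc (Suc n)) x =
     (x - c (n + 2) * sqrt (1 - x\<^sup>2)) * Wfun c d (Suc n) x - d (n + 2) * Wfun c d n x"

fun Rpoly :: "(nat \<Rightarrow> real) \<Rightarrow> (nat \<Rightarrow> real) \<Rightarrow> nat \<Rightarrow> complex poly" where
  "Rpoly c d 0 = 1"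
| "Rpoly c d (Suc 0) = [:1 - \<i> * c 1, 1 + \<i> * c 1:]"
| "Rpoly c d (Suc (Suc n)) =
     [:1 - \<i> * c (n + 2), 1 + \<i> * c (n + 2):] * Rpoly c d (Suc n)
     - [:0, 4 * d (n + 2):] * Rpoly c d n"

definition finite_positive_chain_sequence :: "nat \<Rightarrow> (nat \<Rightarrow> real) \<Rightarrow> bool" where
  "finite_positive_chain_sequence N d \<longleftrightarrow>
     (\<exists>g :: nat \<Rightarrow> real. 0 \<le> g 1 \<and> g 1 < 1 \<and> (\<forall>n\<in>{2..N}. 0 < g n \<and> g n < 1) \<and>
        (\<forall>n\<in>{1..N - 1}. d (n + 1) = (1 - g n) * g (n + 1)))"

definition finite_scaling_sequence :: "nat \<Rightarrow> (nat \<Rightarrow> real) \<Rightarrow> (nat \<Rightarrow> real) \<Rightarrow> bool" where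
  "finite_scaling_sequence N d q \<longleftrightarrow>
     (\<forall>n\<in>{1..N - 1}. 0 < q (n + 1) \<and> q (n + 1) \<le> 1) \<and>
     finite_positive_chain_sequence N (\<lambda>k. d k / q k)"

definition uroots :: "real \<Rightarrow> real \<Rightarrow> real \<Rightarrow> real set" where
  "uroots a b q = {u. (1 - q) * u\<^sup>2 - (a + b) * u + a * b - q = 0}"

text \<open>
  For \<open>0 < q < 1\<close> there are exactly two real roots, so \<open>Min\<close> and \<open>Max\<close> below pick the smaller and
  the larger one.
\<close>

lemma uroots_two:
  assumes "0 < q" "q < 1"
  obtains r s where "r < s" "uroots a b q = {r, s}"
proof -
  define D where "D = (a + b)\<^sup>2 - 4 * (1 - q) * (a * b - q)"
  have "D = q * (a + b)\<^sup>2 + (1 - q) * (a - b)\<^sup>2 + 4 * q * (1 - q)"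
    by (simp add: D_def power2_eq_square algebra_simps)
  then have "D > 0"
    using assms by (simp add: add_nonneg_pos)
  define m where "m = 1 - q"
  have "m > 0"
    using assms by (simp add: m_def)
  define r where "r = (a + b - sqrt D) / (2 * m)"
  define s where "s = (a + b + sqrt D) / (2 * m)"
  have "r < s"
    using \<open>D > 0\<close> \<open>m > 0\<close> by (simp add: r_def s_def divide_strict_right_mono)
  have "r + s = 2 * (a + b) / (2 * m)"
    by (simp add: r_def s_def add_divide_distrib[symmetric])
  then have sum: "m * (r + s) = a + b"
    using \<open>m > 0\<close> by simp
  have "r * s = (a + b - sqrt D) * (a + b + sqrt D) / (4 * m\<^sup>2)"
    by (simp add: r_def s_def power2_eq_square)
  also have "(a + b - sqrt D) * (a + b + sqrt D) = (a + b)\<^sup>2 - (sqrt D)\<^sup>2"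
    by (simp add: power2_eq_square algebra_simps)
  also have "\<dots> = 4 * m * (a * b - q)"
    using \<open>D > 0\<close> by (simp add: D_def m_def)
  finally have prod: "m * (r * s) = a * b - q"
    using \<open>m > 0\<close> by (simp add: power2_eq_square)
  have "m * u\<^sup>2 - (a + b) * u + a * b - q = m * ((u - r) * (u - s))" for u
  proof -
    have "m * u\<^sup>2 - (a + b) * u + a * b - q = m * u\<^sup>2 - m * (r + s) * u + m * (r * s)"
      using sum prod by simp
    then show ?thesis
      by (simp add: power2_eq_square algebra_simps)
  qed
  then have "uroots a b q = {r, s}"
    using \<open>m > 0\<close> by (auto simp: uroots_def m_def[symmetric])
  with \<open>r < s\<close> show thesis
    by (rule that)
qed

definition u_minus :: "real \<Rightarrow> real \<Rightarrow> real \<Rightarrow> ereal" where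
  "u_minus a b q =
     (if q < 1 then ereal (Min (uroots a b q))
      else if a + b \<le> 0 then - \<infinity> else ereal ((a * b - 1) / (a + b)))"

definition u_plus :: "real \<Rightarrow> real \<Rightarrow> real \<Rightarrow> ereal" where
  "u_plus a b q =
     (if q < 1 then ereal (Max (uroots a b q))
      else if a + b \<ge> 0 then \<infinity> else ereal ((a * b - 1) / (a + b)))"

text \<open>The expression \<open>u / sqrt (1 + u\<^sup>2)\<close>, extended by its limits to \<open>u = \<plusminus>\<infinity>\<close>.\<close>

definition sqrt_quotient :: "ereal \<Rightarrow> real" where
  "sqrt_quotient u = (case u of ereal r \<Rightarrow> r / sqrt (1 + r\<^sup>2) | PInfty \<Rightarrow> 1 | MInfty \<Rightarrow> - 1)"

definition A_bound :: "(nat \<Rightarrow> real) \<Rightarrow> (nat \<Rightarrow> real) \<Rightarrow> nat \<Rightarrow> real" where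
  "A_bound c q N = (MIN n\<in>{2..N}. sqrt_quotient (u_minus (c (n - 1)) (c n) (q n)))"

definition B_bound :: "(nat \<Rightarrow> real) \<Rightarrow> (nat \<Rightarrow> real) \<Rightarrow> nat \<Rightarrow> real" where
  "B_bound c q N = (MAX n\<in>{2..N}. sqrt_quotient (u_plus (c (n - 1)) (c n) (q n)))"

end

theory Submission
  imports Defs
begin

text \<open>
  Put \<open>\<alpha>\<^sub>n = x - c\<^sub>n \<surd>(1 - x\<^sup>2)\<close>.  With \<open>u = x / \<surd>(1 - x\<^sup>2)\<close>, the inequality
  \<open>(u - a) (u - b) \<ge> q (1 + u\<^sup>2)\<close> holds outside the interval spanned by the two values \<open>u\<^sup>\<plusminus>(a, b, q)\<close>,
  so for \<open>x\<close> outside the claimed interval \<open>\<alpha>\<^sub>n\<^sub>-\<^sub>1 \<alpha>\<^sub>n \<ge> q\<^sub>n\<close> for every \<open>n\<close>.  Then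
  \<open>d\<^sub>n / (\<alpha>\<^sub>n\<^sub>-\<^sub>1 \<alpha>\<^sub>n)\<close> is dominated by the chain sequence \<open>d\<^sub>n / q\<^sub>n\<close> with parameters \<open>g\<^sub>n\<close>, and
  inductively \<open>W\<^sub>n / (\<alpha>\<^sub>n W\<^sub>n\<^sub>-\<^sub>1) \<ge> 1 - g\<^sub>n > 0\<close>, whence \<open>W\<^sub>N \<noteq> 0\<close>.

  On the unit circle the zeros of \<open>R\<^sub>N\<close> correspond to those of \<open>W\<^sub>N\<close>.  Off the circle, the numbers
  \<open>(1 + i c) z + (1 - i c)\<close> with real \<open>c\<close> form a line that misses the origin; after rotating it to
  a vertical line, a parabola-theorem argument with the parameters of \<open>d\<close> keeps the rotated
  ratios \<open>R\<^sub>n / R\<^sub>n\<^sub>-\<^sub>1\<close> in the right half-plane.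
\<close>

section \<open>The increasing substitution between slopes \<open>u\<close> and points
  \<open>x\<close> of [-1, 1]\<close>

lemma strict_mono_div_sqrt: "strict_mono (\<lambda>r::real. r / sqrt (1 + r\<^sup>2))"
proof (rule strict_monoI)
  fix r s :: real
  assume "r < s"
  then have "sin (arctan r) < sin (arctan s)"
    using arctan_bounded[of r] arctan_bounded[of s]
    by (intro sin_monotone_2pi) (auto simp: arctan_less_iff)
  then show "r / sqrt (1 + r\<^sup>2) < s / sqrt (1 + s\<^sup>2)"
    by (simp add: sin_arctan)
qed

lemma abs_div_sqrt_less_1: "\<bar>r / sqrt (1 + r\<^sup>2)\<bar> < (1::real)"
proof -
  have "\<bar>r\<bar> < sqrt (1 + r\<^sup>2)" "0 < sqrt (1 + r\<^sup>2)"
    by (auto intro!: real_less_rsqrt simp: add_pos_nonneg)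
  then show ?thesis
    by (simp only: abs_divide divide_less_eq_1_pos abs_of_pos)
qed

lemma strict_mono_sqrt_quotient: "strict_mono sqrt_quotient"
proof (rule strict_monoI)
  fix U V :: ereal
  assume "U < V"
  moreover have "-1 < r / sqrt (1 + r\<^sup>2) \<and> r / sqrt (1 + r\<^sup>2) < 1" for r :: real
    using abs_div_sqrt_less_1[of r] by linarith
  ultimately show "sqrt_quotient U < sqrt_quotient V"
    using strict_monoD[OF strict_mono_div_sqrt]
    by (cases U; cases V) (auto simp: sqrt_quotient_def)
qed

lemma sqrt_quotient_bounds: "-1 \<le> sqrt_quotient U" "sqrt_quotient U \<le> 1"
proof -
  have "sqrt_quotient (-\<infinity>) \<le> sqrt_quotient U" "sqrt_quotient U \<le> sqrt_quotient \<infinity>"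
    by (simp_all add: strict_mono_less_eq[OF strict_mono_sqrt_quotient])
  then show "-1 \<le> sqrt_quotient U" "sqrt_quotient U \<le> 1"
    by (simp_all add: sqrt_quotient_def)
qed

section \<open>Nonvanishing of \<open>Wfun\<close> outside the interval\<close>

lemma quadratic_nonneg_outside_uroots:
  assumes "0 < q" "q \<le> 1" and "ereal u \<le> u_minus a b q \<or> u_plus a b q \<le> ereal u"
  shows "(1 - q) * u\<^sup>2 - (a + b) * u + a * b - q \<ge> 0"
proof (cases "q < 1")
  case True
  then obtain r s where "r < s" and rs: "uroots a b q = {r, s}"
    using uroots_two assms(1) by blast
  then have u: "u \<le> r \<or> s \<le> u"
    using assms(3) True by (simp add: u_minus_def u_plus_def)
  have r: "(1 - q) * r\<^sup>2 - (a + b) * r + a * b - q = 0"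
    and s: "(1 - q) * s\<^sup>2 - (a + b) * s + a * b - q = 0"
    using rs unfolding uroots_def by blast+
  then have "(r - s) * ((1 - q) * (r + s) - (a + b)) = 0"
    by (simp add: algebra_simps power2_eq_square)
  then have sum: "a + b = (1 - q) * (r + s)"
    using \<open>r < s\<close> by simp
  have "(1 - q) * u\<^sup>2 - (a + b) * u + a * b - q = (1 - q) * ((u - r) * (u - s))"
    using r unfolding sum by (simp add: algebra_simps power2_eq_square)
  moreover have "(u - r) * (u - s) \<ge> 0"
    using u \<open>r < s\<close> by (auto simp: zero_le_mult_iff)
  ultimately show ?thesis
    using True by simp
next
  case False
  \<comment> \<open>The quadratic is now linear. An infinite root makes its disjunct of the
    hypothesis false, which leaves just the side of the finite root where the linear form is
    nonnegative. For \<open>a + b = 0\<close> both disjuncts are false.\<close>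
  then have "q = 1"
    using assms(2) by simp
  then show ?thesis
    using assms(3)
    by (auto simp: u_minus_def u_plus_def field_simps split: if_splits)
qed

text \<open>Homogenization: with \<open>x = u * y\<close> and
  \<open>y\<^sup>2 * (1 + u\<^sup>2) = 1\<close>, the product minus \<open>q\<close> is
  \<open>y\<^sup>2\<close> times the quadratic at \<open>u\<close>. The endpoints, where
  \<open>y = 0\<close>, are treated separately: there the product is 1.\<close>

lemma scaled_product_ge:
  fixes x :: real
  assumes "0 < q" "q \<le> 1" "x \<in> {-1..1}"
    and "x \<le> sqrt_quotient (u_minus a b q) \<or> sqrt_quotient (u_plus a b q) \<le> x"
  shows "(x - a * sqrt (1 - x\<^sup>2)) * (x - b * sqrt (1 - x\<^sup>2)) \<ge> q"
proof (cases "x\<^sup>2 = 1")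
  case True
  then show ?thesis
    using assms by (simp flip: power2_eq_square)
next
  case False
  define y where "y = sqrt (1 - x\<^sup>2)"
  define u where "u = x / y"
  have "x\<^sup>2 < 1"
    using False assms(3) by (simp add: abs_square_le_1 order_less_le abs_le_iff)
  then have "y > 0" and y2: "y\<^sup>2 = 1 - x\<^sup>2"
    by (simp_all add: y_def)
  have x: "x = u * y"
    using \<open>y > 0\<close> by (simp add: u_def)
  have "y\<^sup>2 * (1 + u\<^sup>2) = 1"
    using y2 by (simp add: x algebra_simps power_mult_distrib)
  then have "sqrt (1 + u\<^sup>2) = 1 / y"
    using \<open>y > 0\<close> by (intro real_sqrt_unique) (auto simp: field_simps)
  then have "x = sqrt_quotient (ereal u)"
    by (simp add: sqrt_quotient_def x)
  then have "ereal u \<le> u_minus a b q \<or> u_plus a b q \<le> ereal u"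
    using assms(4) by (simp add: strict_mono_less_eq[OF strict_mono_sqrt_quotient])
  then have "0 \<le> y\<^sup>2 * ((1 - q) * u\<^sup>2 - (a + b) * u + a * b - q)"
    using quadratic_nonneg_outside_uroots[OF assms(1,2)] by simp
  also have "\<dots> = (x - a * y) * (x - b * y) - q * (y\<^sup>2 * (1 + u\<^sup>2))"
    unfolding x by (simp add: algebra_simps power2_eq_square)
  also have "\<dots> = (x - a * y) * (x - b * y) - q"
    by (simp add: \<open>y\<^sup>2 * (1 + u\<^sup>2) = 1\<close>)
  finally show ?thesis
    by (simp add: y_def)
qed

lemma Wfun_nonzero:
  assumes "N \<ge> 2" and scaling: "finite_scaling_sequence N d q"
    and prod: "\<And>n. n \<in> {2..N} \<Longrightarrow>
      (x - c (n - 1) * sqrt (1 - x\<^sup>2)) * (x - c n * sqrt (1 - x\<^sup>2)) \<ge> q n"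
  shows "Wfun c d N x \<noteq> 0"
proof -
  define \<alpha> where "\<alpha> n = x - c n * sqrt (1 - x\<^sup>2)" for n
  obtain g :: "nat \<Rightarrow> real" where "0 \<le> g 1" "g 1 < 1"
    and g: "\<And>n. n \<in> {2..N} \<Longrightarrow> 0 < g n \<and> g n < 1"
    and dq: "\<And>n. n \<in> {1..N - 1} \<Longrightarrow> d (n + 1) / q (n + 1) = (1 - g n) * g (n + 1)"
    and q: "\<And>n. n \<in> {1..N - 1} \<Longrightarrow> 0 < q (n + 1)"
    using scaling unfolding finite_scaling_sequence_def finite_positive_chain_sequence_def by blast
  have g1: "g n < 1" if "1 \<le> n" "n \<le> N" for n
    using g[of n] \<open>g 1 < 1\<close> that by (cases "n = 1") auto
  have \<alpha>: "\<alpha> n * \<alpha> (Suc n) \<ge> q (Suc n)" "q (Suc n) > 0" if "1 \<le> n" "n < N" for n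
    using prod[of "Suc n"] q[of n] that by (auto simp: \<alpha>_def)
  \<comment> \<open>Only products of consecutive \<open>\<alpha>\<close> are known to be positive.
    Dividing the ratio by \<open>\<alpha> (Suc n)\<close> gives an invariant that does not depend on
    their common sign.\<close>
  have "Wfun c d n x \<noteq> 0 \<and> \<alpha> (Suc n) \<noteq> 0 \<and>
      Wfun c d (Suc n) x / (\<alpha> (Suc n) * Wfun c d n x) \<ge> 1 - g (Suc n)"
    if "n < N" for n
    using that
  proof (induction n)
    case 0
    have "\<alpha> 1 \<noteq> 0"
      using \<alpha>[of 1] \<open>N \<ge> 2\<close> by auto
    then show ?case
      using \<open>0 \<le> g 1\<close> by (simp add: \<alpha>_def)
  next
    case (Suc n)
    define W where "W k = Wfun c d k x" for k
    define \<rho> where "\<rho> = W (Suc n) / (\<alpha> (Suc n) * W n)"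
    define p where "p = \<alpha> (Suc n) * \<alpha> (Suc (Suc n))"
    have IH: "W n \<noteq> 0" "\<alpha> (Suc n) \<noteq> 0" and \<rho>: "\<rho> \<ge> 1 - g (Suc n)"
      using Suc by (simp_all add: W_def \<rho>_def)
    have gn: "1 - g (Suc n) > 0" and gn': "g (Suc (Suc n)) > 0"
      using g1[of "Suc n"] g[of "Suc (Suc n)"] Suc.prems by simp_all
    have p: "p \<ge> q (Suc (Suc n))" and qpos: "q (Suc (Suc n)) > 0"
      using \<alpha>[of "Suc n"] Suc.prems by (simp_all add: p_def)
    have d: "d (Suc (Suc n)) = q (Suc (Suc n)) * ((1 - g (Suc n)) * g (Suc (Suc n)))"
      using dq[of "Suc n"] qpos Suc.prems by (simp add: field_simps)
    have "\<rho> > 0" "p > 0"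
      using \<rho> gn p qpos by linarith+
    then have nz: "W (Suc n) \<noteq> 0" "\<alpha> (Suc (Suc n)) \<noteq> 0"
      by (auto simp: \<rho>_def p_def)
    \<comment> \<open>The lower bounds for \<open>p\<close> and \<open>\<rho>\<close> multiply to
      the part of \<open>d\<close> other than \<open>g (Suc (Suc n))\<close>, so the correction
      \<open>d / (p * \<rho>)\<close> in the next ratio is at most that parameter.\<close>
    have "q (Suc (Suc n)) * (1 - g (Suc n)) \<le> p * \<rho>"
      using p \<rho> qpos gn \<open>p > 0\<close> by (intro mult_mono) auto
    from mult_left_mono[OF this less_imp_le[OF gn']]
    have "d (Suc (Suc n)) \<le> g (Suc (Suc n)) * (p * \<rho>)"
      by (simp add: d mult_ac)
    then have "d (Suc (Suc n)) / (p * \<rho>) \<le> g (Suc (Suc n))"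
      using \<open>\<rho> > 0\<close> \<open>p > 0\<close> by (simp add: divide_le_eq)
    moreover have "W (Suc (Suc n)) = \<alpha> (Suc (Suc n)) * W (Suc n) - d (Suc (Suc n)) * W n"
      by (simp add: W_def \<alpha>_def)
    then have "W (Suc (Suc n)) / (\<alpha> (Suc (Suc n)) * W (Suc n)) = 1 - d (Suc (Suc n)) / (p * \<rho>)"
      using nz IH by (simp add: p_def \<rho>_def field_simps)
    ultimately show ?case
      using nz by (simp add: W_def)
  qed
  from this[of "N - 1"] show ?thesis
    using \<open>N \<ge> 2\<close> g1[of N] by auto
qed

section \<open>Absence of zeros of \<open>Rpoly\<close> off the unit circle\<close>

lemma Re_divide_le:
  assumes "Re w \<ge> p" "p > 0"
  shows "Re (m / w) \<le> (cmod m + Re m) / (2 * p)"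
proof -
  \<comment> \<open>This Moebius map sends the half-plane \<open>Re w \<ge> p\<close> into the
    closed unit disc. Since \<open>1 / w = (1 + \<zeta>) / (2 * p)\<close>, the reciprocal lies in a
    disc through 0.\<close>
  define \<zeta> where "\<zeta> = (2 * of_real p - w) / w"
  have "w \<noteq> 0"
    using assms by auto
  have "(2 * p - Re w)\<^sup>2 \<le> (Re w)\<^sup>2"
    using assms by (intro power2_le_iff_abs_le[THEN iffD2]) auto
  then have "cmod (2 * of_real p - w) \<le> cmod w"
    by (simp add: cmod_def)
  then have "cmod \<zeta> \<le> 1"
    using \<open>w \<noteq> 0\<close> by (simp add: \<zeta>_def norm_divide divide_le_eq)
  then have "cmod (m * \<zeta>) \<le> cmod m"
    by (simp add: norm_mult mult_left_le)
  then have "Re (m * \<zeta>) \<le> cmod m"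
    using complex_Re_le_cmod order_trans by blast
  moreover have "m / w = (m * \<zeta> + m) / of_real (2 * p)"
    using \<open>w \<noteq> 0\<close> assms(2) by (simp add: \<zeta>_def field_simps)
  then have "Re (m / w) = (Re (m * \<zeta>) + Re m) / (2 * p)"
    by (simp only: Re_divide_of_real plus_complex.sel)
  ultimately show ?thesis
    using assms(2) by (simp add: divide_right_mono)
qed

lemma Re_of_real_mult: "Re (of_real r * w) = r * Re w"
  by simp

text \<open>Places the coefficient of the rotated recurrence in a parabolic region. With
  \<open>\<rho> = cmod z\<close> and \<open>X = Re z\<close>, the left side factors as
  \<open>(\<rho> - 1)\<^sup>2 * (2 * (\<rho> + X))\<close>, and
  \<open>2 * (\<rho> + X) \<le> 4 * \<rho> \<le> (\<rho> + 1)\<^sup>2\<close>.\<close>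

lemma parabola_bound:
  defines "m \<equiv> \<lambda>z::complex. z * (cnj (z - 1))\<^sup>2"
  shows "2 * (cmod (m z) + Re (m z)) \<le> ((cmod z)\<^sup>2 - 1)\<^sup>2"
proof -
  define \<rho> where "\<rho> = cmod z"
  define X where "X = Re z"
  have \<rho>2: "\<rho>\<^sup>2 = X\<^sup>2 + (Im z)\<^sup>2"
    by (simp add: \<rho>_def X_def cmod_power2)
  have "(cmod (z - 1))\<^sup>2 = \<rho>\<^sup>2 + 1 - 2 * X"
    unfolding \<rho>2 cmod_power2 by (simp add: X_def power2_eq_square algebra_simps)
  then have norm: "cmod (m z) = \<rho> * (\<rho>\<^sup>2 + 1 - 2 * X)"
    by (simp only: m_def norm_mult norm_power complex_mod_cnj \<rho>_def)
  have Re: "Re (m z) = (\<rho>\<^sup>2 + 1) * X - 2 * \<rho>\<^sup>2"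
    unfolding \<rho>2 by (simp add: m_def X_def power2_eq_square algebra_simps)
  have "X \<le> \<rho>"
    by (simp add: X_def \<rho>_def complex_Re_le_cmod)
  have "2 * (cmod (m z) + Re (m z)) = (\<rho> - 1)\<^sup>2 * (2 * (\<rho> + X))"
    unfolding norm Re by (simp add: power2_eq_square algebra_simps)
  also have "\<dots> \<le> (\<rho> - 1)\<^sup>2 * (\<rho> + 1)\<^sup>2"
  proof (rule mult_left_mono)
    have "(\<rho> + 1)\<^sup>2 - 4 * \<rho> = (\<rho> - 1)\<^sup>2"
      by (simp add: power2_eq_square algebra_simps)
    then have "4 * \<rho> \<le> (\<rho> + 1)\<^sup>2"
      using zero_le_power2[of "\<rho> - 1"] by linarith
    moreover have "2 * (\<rho> + X) \<le> 4 * \<rho>"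
      using \<open>X \<le> \<rho>\<close> by simp
    ultimately show "2 * (\<rho> + X) \<le> (\<rho> + 1)\<^sup>2"
      by (rule order_trans[rotated])
  qed simp
  also have "\<dots> = (\<rho>\<^sup>2 - 1)\<^sup>2"
    by (simp add: power2_eq_square algebra_simps)
  finally show ?thesis
    by (simp add: \<rho>_def)
qed

lemma Rpoly_nonzero_off_circle:
  assumes "N \<ge> 2" and chain: "finite_positive_chain_sequence N d" and "cmod z \<noteq> 1"
  shows "poly (Rpoly c d N) z \<noteq> 0"
proof -
  obtain g :: "nat \<Rightarrow> real" where "0 \<le> g 1" "g 1 < 1"
    and g: "\<And>n. n \<in> {2..N} \<Longrightarrow> 0 < g n \<and> g n < 1"
    and d: "\<And>n. n \<in> {1..N - 1} \<Longrightarrow> d (n + 1) = (1 - g n) * g (n + 1)"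
    using chain unfolding finite_positive_chain_sequence_def by blast
  have g1: "g n < 1" if "1 \<le> n" "n \<le> N" for n
    using g[of n] \<open>g 1 < 1\<close> that by (cases "n = 1") auto
  define h where "h = \<bar>(cmod z)\<^sup>2 - 1\<bar>"
  \<comment> \<open>As \<open>\<beta> n = (1 + z) + \<i> * c n * (z - 1)\<close>, the factor
    \<open>cnj (z - 1)\<close> turns the contribution of \<open>c n\<close> purely imaginary. The
    remaining real part is \<open>(cmod z)\<^sup>2 - 1\<close>, made positive by the sign
    factor.\<close>
  define \<kappa> where "\<kappa> = of_real (sgn ((cmod z)\<^sup>2 - 1)) * cnj (z - 1)"
  define \<beta> where "\<beta> n = 1 - \<i> * c n + z * (1 + \<i> * c n)" for n
  define R where "R n = poly (Rpoly c d n) z" for n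
  have ne: "(cmod z)\<^sup>2 - 1 \<noteq> 0"
    using \<open>cmod z \<noteq> 1\<close> power2_eq_1_iff[of "cmod z"] norm_ge_zero[of z] by auto
  then have "h > 0"
    by (simp add: h_def)
  have "z \<noteq> 1"
    using \<open>cmod z \<noteq> 1\<close> by auto
  then have "\<kappa> \<noteq> 0"
    using ne by (simp add: \<kappa>_def sgn_zero_iff)
  have Re_\<beta>: "Re (\<kappa> * \<beta> n) = h" for n
  proof -
    have "Re (cnj (z - 1) * \<beta> n) = (cmod z)\<^sup>2 - 1"
      unfolding cmod_power2 by (simp add: \<beta>_def algebra_simps power2_eq_square)
    moreover have "\<kappa> * \<beta> n = of_real (sgn ((cmod z)\<^sup>2 - 1)) * (cnj (z - 1) * \<beta> n)"
      by (simp add: \<kappa>_def mult.assoc)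
    ultimately show ?thesis
      by (simp only: Re_of_real_mult h_def abs_sgn) (simp add: mult.commute)
  qed
  have \<kappa>2: "z * \<kappa>\<^sup>2 = z * (cnj (z - 1))\<^sup>2"
  proof -
    have "(sgn ((cmod z)\<^sup>2 - 1))\<^sup>2 = 1"
      using ne by (auto simp: sgn_real_def)
    then show ?thesis
      by (simp add: \<kappa>_def power_mult_distrib flip: of_real_power)
  qed
  have bound: "2 * (cmod (z * \<kappa>\<^sup>2) + Re (z * \<kappa>\<^sup>2)) \<le> h\<^sup>2"
    using parabola_bound[of z] by (simp only: \<kappa>2 h_def power2_abs)
  \<comment> \<open>The chain-sequence induction again, now for real parts, with \<open>h\<close> as
    the unit and the parameters of \<open>d\<close> itself.\<close>
  have "R n \<noteq> 0 \<and> Re (\<kappa> * R (Suc n) / R n) \<ge> (1 - g (Suc n)) * h" if "n < N" for n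
    using that
  proof (induction n)
    case 0
    have "R 0 = 1" "R (Suc 0) = \<beta> 1"
      by (simp_all add: R_def \<beta>_def)
    then show ?case
      using Re_\<beta>[of 1] \<open>0 \<le> g 1\<close> \<open>h > 0\<close> by (simp add: algebra_simps)
  next
    case (Suc n)
    define w where "w = \<kappa> * R (Suc n) / R n"
    define e where "e = g (Suc (Suc n))"
    define f where "f = 1 - g (Suc n)"
    define m where "m = z * \<kappa>\<^sup>2"
    have "R n \<noteq> 0" and w: "Re w \<ge> f * h"
      using Suc by (simp_all add: w_def f_def)
    have "f > 0" "e > 0"
      using g1[of "Suc n"] g[of "Suc (Suc n)"] Suc.prems by (simp_all add: f_def e_def)
    then have "f * h > 0"
      using \<open>h > 0\<close> by simp
    then have "w \<noteq> 0"
      using w by auto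
    then have "R (Suc n) \<noteq> 0"
      by (auto simp: w_def)
    have d': "d (Suc (Suc n)) = f * e"
      using d[of "Suc n"] Suc.prems by (simp add: f_def e_def)
    have rec: "R (Suc (Suc n)) = \<beta> (Suc (Suc n)) * R (Suc n) - 4 * of_real (f * e) * z * R n"
      unfolding d'[symmetric] by (simp add: R_def \<beta>_def algebra_simps)
    have "\<kappa> * R (Suc (Suc n)) / R (Suc n)
        = \<kappa> * \<beta> (Suc (Suc n)) - of_real (4 * (f * e)) * (m / w)"
      using \<open>R n \<noteq> 0\<close> \<open>R (Suc n) \<noteq> 0\<close> \<open>\<kappa> \<noteq> 0\<close> unfolding rec
      by (simp add: w_def m_def field_simps power2_eq_square)
    then have *: "Re (\<kappa> * R (Suc (Suc n)) / R (Suc n)) = h - 4 * (f * e) * Re (m / w)"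
      by (simp only: minus_complex.sel Re_\<beta> Re_of_real_mult)
    \<comment> \<open>The half-plane bound is applied with \<open>p = f * h\<close>. Then
      \<open>f\<close> cancels and the parabola bound leaves exactly \<open>e * h\<close>.\<close>
    have "4 * (f * e) * Re (m / w) \<le> 4 * (f * e) * ((cmod m + Re m) / (2 * (f * h)))"
      using Re_divide_le[OF w \<open>f * h > 0\<close>] \<open>f > 0\<close> \<open>e > 0\<close> by (intro mult_left_mono) auto
    also have "\<dots> = e * (2 * (cmod m + Re m)) / h"
      using \<open>f > 0\<close> \<open>h > 0\<close> by (simp add: field_simps)
    also have "\<dots> \<le> e * h\<^sup>2 / h"
      using bound \<open>e > 0\<close> \<open>h > 0\<close> unfolding m_def
      by (intro divide_right_mono mult_left_mono) auto
    also have "\<dots> = e * h"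
      using \<open>h > 0\<close> by (simp add: power2_eq_square)
    finally show ?case
      using \<open>R (Suc n) \<noteq> 0\<close> unfolding * by (simp add: e_def algebra_simps)
  qed
  from this[of "N - 1"] have "Re (\<kappa> * R N / R (N - 1)) \<ge> (1 - g N) * h"
    using \<open>N \<ge> 2\<close> by simp
  moreover have "(1 - g N) * h > 0"
    using g1[of N] \<open>N \<ge> 2\<close> \<open>h > 0\<close> by simp
  ultimately show ?thesis
    by (auto simp: R_def)
qed

section \<open>Passage to the unit circle and conclusion\<close>

lemma poly_Rpoly_cis:
  assumes "0 \<le> \<phi>" "\<phi> \<le> pi"
  shows "poly (Rpoly c d n) (cis (2 * \<phi>)) = (2 * cis \<phi>) ^ n * of_real (Wfun c d n (cos \<phi>))"
proof -
  have z: "cis (2 * \<phi>) = cis \<phi> * cis \<phi>"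
    by (simp add: cis_mult)
  \<comment> \<open>The range of \<open>\<phi>\<close> fixes the sign of the root.\<close>
  have W: "sqrt (1 - (cos \<phi>)\<^sup>2) = sin \<phi>"
    using assms by (simp add: sin_ge_zero flip: sin_squared_eq)
  \<comment> \<open>Each linear factor yields one \<open>2 * cis \<phi>\<close>, and
    \<open>4 * z\<close> in the last term of the recurrence is its square, so both terms scale
    alike.\<close>
  have \<beta>: "1 - \<i> * of_real a + cis (2 * \<phi>) * (1 + \<i> * of_real a)
      = 2 * cis \<phi> * of_real (cos \<phi> - a * sin \<phi>)" for a :: real
  proof -
    have "1 + cos (2 * \<phi>) - a * sin (2 * \<phi>) = 2 * cos \<phi> * (cos \<phi> - a * sin \<phi>)"
      unfolding cos_double_cos sin_double by (simp add: power2_eq_square algebra_simps)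
    moreover have "sin (2 * \<phi>) - a * (1 - cos (2 * \<phi>)) = 2 * sin \<phi> * (cos \<phi> - a * sin \<phi>)"
      unfolding cos_double_sin sin_double by (simp add: power2_eq_square algebra_simps)
    ultimately show ?thesis
      by (simp add: complex_eq_iff algebra_simps)
  qed
  show ?thesis
  proof (induction n rule: induct_nat_012)
    case 1
    show ?case
      using \<beta>[of "c 1"] by (simp add: W)
  next
    case (ge2 n)
    have "poly (Rpoly c d (Suc (Suc n))) (cis (2 * \<phi>))
      = (1 - \<i> * c (n + 2) + cis (2 * \<phi>) * (1 + \<i> * c (n + 2))) * poly (Rpoly c d (Suc n)) (cis (2 * \<phi>))
        - 4 * d (n + 2) * cis (2 * \<phi>) * poly (Rpoly c d n) (cis (2 * \<phi>))"
      by (simp add: distrib_right mult.assoc)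
    also have "\<dots> = (2 * cis \<phi>) ^ Suc (Suc n) * of_real (Wfun c d (Suc (Suc n)) (cos \<phi>))"
      unfolding \<beta> ge2 unfolding z by (simp add: W algebra_simps)
    finally show ?case .
  qed simp
qed

theorem theorem4p3:
  fixes N :: nat and c d q :: "nat \<Rightarrow> real"
  assumes "N \<ge> 2"
    and "finite_positive_chain_sequence N d"
    and "finite_scaling_sequence N d q"
  shows "(\<forall>x\<in>{-1..1}. Wfun c d N x = 0 \<longrightarrow> x \<in> {A_bound c q N<..<B_bound c q N}) \<and>
         (\<forall>z. poly (Rpoly c d N) z = 0 \<longrightarrow>
              z \<in> open_arc (2 * arccos (B_bound c q N)) (2 * arccos (A_bound c q N)))"
proof -
  have q: "0 < q n" "q n \<le> 1" if "n \<in> {2..N}" for n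
  proof -
    have "n - 1 \<in> {1..N - 1}" "n - 1 + 1 = n"
      using that by auto
    then show "0 < q n" "q n \<le> 1"
      using assms(3) unfolding finite_scaling_sequence_def by metis+
  qed
  have A: "A_bound c q N \<le> sqrt_quotient (u_minus (c (n - 1)) (c n) (q n))"
    and B: "sqrt_quotient (u_plus (c (n - 1)) (c n) (q n)) \<le> B_bound c q N" if "n \<in> {2..N}" for n
    using that unfolding A_bound_def B_bound_def by (auto intro!: Min_le Max_ge)
  have W: "x \<in> {A_bound c q N<..<B_bound c q N}" if "x \<in> {-1..1}" "Wfun c d N x = 0" for x
  proof (rule ccontr)
    assume "\<not> ?thesis"
    then have "x \<le> A_bound c q N \<or> B_bound c q N \<le> x"
      by auto
    then have "x \<le> sqrt_quotient (u_minus (c (n - 1)) (c n) (q n)) \<or>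
        sqrt_quotient (u_plus (c (n - 1)) (c n) (q n)) \<le> x" if "n \<in> {2..N}" for n
      using A[OF that] B[OF that] by linarith
    then have "Wfun c d N x \<noteq> 0"
      using Wfun_nonzero[OF assms(1,3)] scaled_product_ge q \<open>x \<in> {-1..1}\<close> by blast
    with that show False
      by simp
  qed
  \<comment> \<open>Together with \<open>A < cos \<phi> < B\<close> this keeps all arguments in
    [-1, 1], where \<open>arccos\<close> strictly decreases.\<close>
  have AB: "-1 \<le> A_bound c q N" "B_bound c q N \<le> 1"
    using assms(1) unfolding A_bound_def B_bound_def by (auto simp: sqrt_quotient_bounds)
  have "z \<in> open_arc (2 * arccos (B_bound c q N)) (2 * arccos (A_bound c q N))"
    if z0: "poly (Rpoly c d N) z = 0" for z
  proof -
    have "cmod z = 1"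
      using Rpoly_nonzero_off_circle[OF assms(1,2)] z0 by blast
    then have "(Re z)\<^sup>2 + (Im z)\<^sup>2 = 1"
      using cmod_power2[of z] by simp
    then obtain \<theta> where \<theta>: "0 \<le> \<theta>" "\<theta> < 2 * pi" and z: "z = cis \<theta>"
      by (rule sincos_total_2pi) (simp add: complex_eq_iff)
    \<comment> \<open>With \<open>\<theta>\<close> taken in [0, 2 \<pi>), the half angle lies in
      [0, \<pi>], where \<open>arccos\<close> inverts \<open>cos\<close>.\<close>
    define \<phi> where "\<phi> = \<theta> / 2"
    have \<phi>: "0 \<le> \<phi>" "\<phi> \<le> pi" "z = cis (2 * \<phi>)"
      using \<theta> z by (simp_all add: \<phi>_def)
    have "Wfun c d N (cos \<phi>) = 0"
      using z0 poly_Rpoly_cis[OF \<phi>(1,2), of c d N] by (simp add: \<phi>(3))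
    then have "cos \<phi> \<in> {A_bound c q N<..<B_bound c q N}"
      using W[of "cos \<phi>"] by simp
    then have "arccos (B_bound c q N) < arccos (cos \<phi>)" "arccos (cos \<phi>) < arccos (A_bound c q N)"
      using AB by (auto intro!: arccos_less_arccos)
    then show ?thesis
      using \<phi> unfolding open_arc_def cis_conv_exp
      by (auto simp: arccos_cos intro!: exI[of _ "2 * \<phi>"])
  qed
  with W show ?thesis
    by blast
qed

end
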